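(* Let $n\ge 1$ and $0\le k\leq n$ be integers. Let $J_{n,k}$ be the set of 2-colored juggling sequences $T$ such that $T$ is $n(k!)$-periodic, juggles $k$ balls, has the ground state, and $|T|$ is $n$-periodic. Then there is a bijection $\psi:\mathcal{B}_{n,k}\rightarrow J_{n,k}$.
   Context: Signed permutations: $B_n$ is the group of bijections $\pi$ of $\{-n,\dots,n\}$ with $\pi(-i)=-\pi(i)$, written $\pi=\pi(1),\dots,\pi(n)$. The type B maximum drop is $\mathrm{maxdrop}_B(\pi)=\max\big\{\max\{i-\pi(i):1\le i\le n,\ \pi(i)>0\},\ \max\{i:1\le i\le n,\ \pi(i)<0\}\big\}$ (an empty inner maximum is disregarded), and $\mathcal{B}_{n,k}=\{\pi\in B_n:\mathrm{maxdrop}_B(\pi)\le k\}$. Juggling sequences: an $N$-periodic (1-colored) juggling sequence is a sequence $T=(t_1,\dots,t_N)$ of nonnegative integers such that the values $t_i+i \bmod N$ are all distinct ($1\le i\le N$). It is thought of as repeated indefinitely with period $N$. The number of balls juggled is the average $\frac1N\sum_{i=1}^N t_i$, which is an integer. The state of $T$ is the binary sequence $(\sigma_1,\sigma_2,\dots)$ with $\sigma_i=1$ if and only if there are $j\in\{1,\dots,N\}$ and an integer $d>0$ with $t_j+j=i+dN$ (trailing zeros are dropped). If $T$ juggles $k$ balls, it has the ground state if its state is $(1,1,\dots,1)$ with $k$ ones, i.e. $\sigma_i=1$ for $1\le i\le k$ and $\sigma_i=0$ for $i>k$. 2-colored juggling sequences: an $N$-periodic 2-colored (signed) juggling sequence is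 a sequence $T=(t_1,\dots,t_N)$ of integers such that the values $|t_i|+i\bmod N$ are all distinct and $\mathrm{sgn}(t_i)=\mathrm{sgn}(t_j)$ whenever $1\le i\le N$ and $j\in\{1,\dots,N\}$ satisfies $j\equiv i+|t_i| \pmod N$ (with $\mathrm{sgn}(0)=0$). Put $|T|=(|t_1|,\dots,|t_N|)$, a 1-colored juggling sequence; the state of $T$ is the state of $|T|$, and $T$ juggles $k$ balls if $|T|$ does. Periods are not required to be minimal. For $N=n(k!)$, "$T$ is $n(k!)$-periodic" means $T$ is given as a sequence $(t_1,\dots,t_N)$ of $N$ integers such that the values $|t_i|+i\bmod N$ are all distinct and $\mathrm{sgn}(t_i)=\mathrm{sgn}(t_j)$ whenever $i,j\in\{1,\dots,N\}$ satisfy $j\equiv i+|t_i| \pmod N$, and "$|T|$ is $n$-periodic" means $|t_{i+n}|=|t_i|$ for all $1\le i\le N-n$. *)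

theory Defs
  imports Complex_Main "HOL-Library.FuncSet" "HOL-Combinatorics.Permutations" "HOL-Number_Theory.Cong"
begin

text \<open>Signed permutations act on \<open>{-n..n}\<close>; \<open>permutes\<close> makes them the identity outside, so each
  of them is represented by exactly one function.\<close>

definition signed_perms :: "nat \<Rightarrow> (int \<Rightarrow> int) set" where
  "signed_perms n =
     {\<pi>. \<pi> permutes {- int n..int n} \<and> (\<forall>i\<in>{- int n..int n}. \<pi> (- i) = - \<pi> i)}"

text \<open>The maximum of the two inner maxima, where an empty one is disregarded, is the maximum of the
  union of the two sets. For \<open>n \<ge> 1\<close> this union is nonempty, since \<open>\<pi>\<close> has its only zero at 0.\<close>

definition maxdrop_B :: "nat \<Rightarrow> (int \<Rightarrow> int) \<Rightarrow> int" where
  "maxdrop_B n \<pi> =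
     Max ({i - \<pi> i | i. 1 \<le> i \<and> i \<le> int n \<and> \<pi> i > 0} \<union> {i. 1 \<le> i \<and> i \<le> int n \<and> \<pi> i < 0})"

definition signed_perms_maxdrop_le :: "nat \<Rightarrow> nat \<Rightarrow> (int \<Rightarrow> int) set" where
  "signed_perms_maxdrop_le n k = {\<pi> \<in> signed_perms n. maxdrop_B n \<pi> \<le> int k}"

text \<open>A sequence \<open>(t\<^sub>1, \<dots>, t\<^sub>N)\<close> is a function that is \<open>extensional\<close> on \<open>{1..N}\<close>, so that distinct
  functions are distinct sequences.\<close>

definition juggles :: "nat \<Rightarrow> (nat \<Rightarrow> nat) \<Rightarrow> nat \<Rightarrow> bool" where
  "juggles N t k \<longleftrightarrow> (\<Sum>i = 1..N. real (t i)) / real N = real k"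

text \<open>Only the entries \<open>state N t i\<close> with \<open>i \<ge> 1\<close> are meaningful. Dropping trailing zeros is rendered by
  keeping the infinite 0-1 sequence.\<close>

definition state :: "nat \<Rightarrow> (nat \<Rightarrow> nat) \<Rightarrow> nat \<Rightarrow> nat" where
  "state N t i = (if \<exists>j\<in>{1..N}. \<exists>d>0. t j + j = i + d * N then 1 else 0)"

definition has_ground_state :: "nat \<Rightarrow> (nat \<Rightarrow> nat) \<Rightarrow> bool" where
  "has_ground_state N t \<longleftrightarrow>
     (\<exists>k. juggles N t k \<and> (\<forall>i\<ge>1. state N t i = (if i \<le> k then 1 else 0)))"

definition abs_seq :: "nat \<Rightarrow> (nat \<Rightarrow> int) \<Rightarrow> nat \<Rightarrow> nat" where
  "abs_seq N T = (\<lambda>i\<in>{1..N}. nat \<bar>T i\<bar>)"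

definition signed_juggling_seq :: "nat \<Rightarrow> (nat \<Rightarrow> int) \<Rightarrow> bool" where
  "signed_juggling_seq N T \<longleftrightarrow>
     T \<in> extensional {1..N} \<and>
     inj_on (\<lambda>i. (nat \<bar>T i\<bar> + i) mod N) {1..N} \<and>
     (\<forall>i\<in>{1..N}. \<forall>j\<in>{1..N}. [j = i + nat \<bar>T i\<bar>] (mod N) \<longrightarrow> sgn (T i) = sgn (T j))"

definition signed_juggling_seqs :: "nat \<Rightarrow> nat \<Rightarrow> (nat \<Rightarrow> int) set" where
  "signed_juggling_seqs n k =
     (let N = n * fact k in
      {T. signed_juggling_seq N T \<and>
          juggles N (abs_seq N T) k \<and>
          has_ground_state N (abs_seq N T) \<and>
          (\<forall>i\<in>{1..N - n}. abs_seq N T (i + n) = abs_seq N T i)})"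

end

theory Submission
  imports Defs
begin

text \<open>A signed permutation \<open>\<pi>\<close> with drops at most \<open>k\<close> amounts to the permutation \<open>g = \<bar>\<pi>\<bar>\<close> of \<open>{1..n}\<close>,
  which satisfies \<open>g i \<ge> i - k\<close>, and the signs of \<open>\<pi> 1, \<dots>, \<pi> k\<close>; the other entries are positive.
  An \<open>n\<close>-periodic sequence \<open>t\<close> is a \<open>k\<close>-ball juggling sequence with ground state iff its landing map
  \<open>f i = t i + i\<close> sends \<open>{1..}\<close> bijectively onto \<open>{k<..}\<close>. Then \<open>f\<close> maps each period to itself shifted
  by \<open>k\<close>, so \<open>t i = g i + k - i\<close> on \<open>{1..n}\<close> for a permutation \<open>g\<close> as above. A colouring that is constant
  along the orbits of \<open>f\<close> is an arbitrary choice of signs for the \<open>k\<close> balls, which are named by their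
  first landing times \<open>1, \<dots>, k\<close>. Such a colouring is automatically \<open>n * fact k\<close>-periodic, because
  translation by \<open>n\<close> permutes the \<open>k\<close> balls.\<close>

text \<open>Two of the first \<open>card A + 1\<close> points of the orbit of \<open>x\<close>
  coincide by pigeonhole. Cancelling their common initial iterates makes \<open>x\<close> periodic
  with a period of at most \<open>card A\<close>, and such a period divides the factorial. The
  factor \<open>fact k\<close> in the length of the sequences comes from here.\<close>

lemma funpow_fact_eq_id:
  fixes h :: "'a \<Rightarrow> 'a"
  assumes "finite A" "inj_on h A" "h ` A \<subseteq> A" "x \<in> A"
  shows "(h ^^ fact (card A)) x = x"
proof -
  have mem: "(h ^^ m) y \<in> A" if "y \<in> A" for m y
    using that assms(3) by (induction m) auto
  have "\<not> inj_on (\<lambda>m. (h ^^ m) x) {0..card A}"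
  proof
    assume "inj_on (\<lambda>m. (h ^^ m) x) {0..card A}"
    then have "card {0..card A} \<le> card A"
      by (rule card_inj_on_le) (use mem assms in auto)
    then show False by simp
  qed
  then obtain a b where ab: "a < b" "b \<le> card A" "(h ^^ a) x = (h ^^ b) x"
    unfolding inj_on_def by (metis atLeastAtMost_iff linorder_neqE_nat)
  have cancel: "u = v" if "(h ^^ m) u = (h ^^ m) v" "u \<in> A" "v \<in> A" for m u v
    using that
  proof (induction m)
    case (Suc m)
    then show ?case using assms(2) mem by (auto dest: inj_onD)
  qed simp
  have "(h ^^ a) x = (h ^^ a) ((h ^^ (b - a)) x)"
    using ab by (simp flip: funpow_add comp_apply[of "h ^^ a" "h ^^ (b - a)"])
  then have fixed: "(h ^^ (b - a)) x = x"
    using cancel mem assms(4) by metis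
  have "(b - a) dvd fact (card A)"
    using ab by (intro dvd_fact) auto
  then obtain q where q: "fact (card A) = (b - a) * q" by (elim dvdE)
  have "((h ^^ (b - a)) ^^ q) x = x"
    using fixed by (induction q) auto
  then show ?thesis by (simp add: q funpow_mult)
qed

section \<open>Periodic landing maps and the orbits of their balls\<close>

locale periodic_throws =
  fixes n k :: nat and f :: "nat \<Rightarrow> nat"
  assumes n_pos: "0 < n"
    and le: "1 \<le> i \<Longrightarrow> i \<le> f i"
    and shift: "1 \<le> i \<Longrightarrow> f (i + n) = f i + n"
    and bij: "bij_betw f {1..} {k<..}"
begin

lemma inj: "f i = f j \<Longrightarrow> 1 \<le> i \<Longrightarrow> 1 \<le> j \<Longrightarrow> i = j"
  using bij by (auto simp: bij_betw_def dest: inj_onD)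

lemma gt: "1 \<le> i \<Longrightarrow> k < f i"
  using bij by (force simp: bij_betw_def)

lemma obtain_preimage:
  assumes "k < v"
  obtains i where "1 \<le> i" "v = f i"
  using assms bij unfolding bij_betw_def by (metis atLeast_iff greaterThan_iff imageE)

lemma shift_mult: "1 \<le> i \<Longrightarrow> f (i + m * n) = f i + m * n"
proof (induction m)
  case (Suc m)
  then show ?case using shift[of "i + m * n"] by (simp add: algebra_simps)
qed simp

text \<open>If a throw of the first \<open>m\<close> periods landed beyond \<open>k + m * n\<close>,
  moving its landing time back by \<open>m * n\<close> would give another landing time, and the
  throw with that landing, moved forward again, would collide with the first. Conversely, all later
  throws land after \<open>k + m * n\<close>.\<close>

lemma image_period: "f ` {1..m * n} = {k<..k + m * n}"
proof (intro equalityI subsetI)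
  fix v assume "v \<in> f ` {1..m * n}"
  then obtain i where i: "1 \<le> i" "i \<le> m * n" "v = f i" by auto
  have "\<not> k + m * n < v"
  proof
    assume a: "k + m * n < v"
    then obtain j where j: "1 \<le> j" "v - m * n = f j"
      by (metis obtain_preimage less_diff_conv)
    then have "f (j + m * n) = f i" using i a shift_mult[of j m] by simp
    then show False using inj[of "j + m * n" i] i j by simp
  qed
  then show "v \<in> {k<..k + m * n}" using gt i by auto
next
  fix v assume v: "v \<in> {k<..k + m * n}"
  then obtain i where i: "1 \<le> i" "v = f i" using obtain_preimage by auto
  have "\<not> m * n < i"
  proof
    assume a: "m * n < i"
    then have "f i = f (i - m * n) + m * n" using shift_mult[of "i - m * n" m] by simp
    moreover have "1 \<le> i - m * n" using a by simp
    ultimately show False using gt[of "i - m * n"] i v by simp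
  qed
  then show "v \<in> f ` {1..m * n}" using i by auto
qed

lemma inj_period: "inj_on f {1..N}"
  using inj by (auto intro!: inj_onI)

text \<open>Landing times are a rearrangement of the throwing times moved by \<open>k\<close>, so
  each throw contributes \<open>k\<close> on average.\<close>

lemma sum_throws: "(\<Sum>i = 1..m * n. f i - i) = m * n * k"
proof -
  have "(\<Sum>i = 1..m * n. f i - i) + (\<Sum>i = 1..m * n. i) = (\<Sum>i = 1..m * n. f i)"
    unfolding sum.distrib[symmetric] by (rule sum.cong) (use le in auto)
  also have "\<dots> = \<Sum>{k<..k + m * n}"
    using sum.reindex[OF inj_period, of "\<lambda>x. x" "m * n"] image_period by simp
  also have "{k<..k + m * n} = (\<lambda>i. i + k) ` {1..m * n}"
    by (auto simp: image_iff intro!: bexI[of _ "_ - k"])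
  also have "\<Sum>\<dots> = (\<Sum>i = 1..m * n. i + k)"
    by (subst sum.reindex) (auto simp: inj_on_def)
  also have "\<dots> = m * n * k + (\<Sum>i = 1..m * n. i)"
    by (simp add: sum.distrib)
  finally show ?thesis by simp
qed

text \<open>The ball thrown at time \<open>i\<close> is named after its first landing time, which is among \<open>1, \<dots>, k\<close>.
  The value is junk for an empty throw \<open>f i = i\<close>, where the colour is multiplied by \<open>0\<close>.\<close>

definition ball :: "nat \<Rightarrow> nat" where
  "ball i = (SOME a. a \<in> {1..k} \<and> (\<exists>m. (f ^^ m) a = i))"

lemma funpow_ge_1: "1 \<le> a \<Longrightarrow> 1 \<le> (f ^^ m) a"
proof (induction m)
  case (Suc m)
  then show ?case using le[of "(f ^^ m) a"] by auto
qed simp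

lemma funpow_gt: "1 \<le> a \<Longrightarrow> 0 < m \<Longrightarrow> k < (f ^^ m) a"
  using gt funpow_ge_1 by (cases m) auto

lemma funpow_cancel: "(f ^^ m) a = (f ^^ m) b \<Longrightarrow> 1 \<le> a \<Longrightarrow> 1 \<le> b \<Longrightarrow> a = b"
proof (induction m)
  case (Suc m)
  then show ?case using inj funpow_ge_1 by auto
qed simp

lemma funpow_shift: "1 \<le> a \<Longrightarrow> (f ^^ m) (a + n) = (f ^^ m) a + n"
proof (induction m)
  case (Suc m)
  then show ?case using shift funpow_ge_1 by simp
qed simp

text \<open>Cancelling \<open>m\<close> throws puts \<open>a\<close> on the orbit of
  \<open>b\<close> after \<open>d\<close> throws. Every landing is later than \<open>k\<close>,
  whereas \<open>a\<close> is not, so \<open>d = 0\<close>.\<close>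

lemma origin_unique_aux:
  assumes "(f ^^ m) a = (f ^^ (m + d)) b" "a \<in> {1..k}" "b \<in> {1..k}"
  shows "a = b"
proof -
  have "(f ^^ m) a = (f ^^ m) ((f ^^ d) b)" using assms by (simp add: funpow_add)
  then have "a = (f ^^ d) b" using assms funpow_cancel funpow_ge_1 by simp
  moreover have "d = 0" using calculation funpow_gt[of b d] assms by fastforce
  ultimately show ?thesis by simp
qed

lemma origin_unique:
  assumes "(f ^^ m) a = (f ^^ m') b" "a \<in> {1..k}" "b \<in> {1..k}"
  shows "a = b"
  by (metis assms origin_unique_aux le_add_diff_inverse nat_le_linear)

text \<open>Going back along preimages strictly decreases the time as long as the throws are
  nonempty. The descent can only stop at a time that is not a landing, that is, at one of
  \<open>1, ..., k\<close>.\<close>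

lemma origin_exists:
  assumes "1 \<le> i" "f i \<noteq> i"
  shows "\<exists>a\<in>{1..k}. \<exists>m. (f ^^ m) a = i"
  using assms
proof (induction i rule: less_induct)
  case (less i)
  show ?case
  proof (cases "i \<le> k")
    case True
    then show ?thesis using less.prems by (intro bexI[of _ i] exI[of _ 0]) auto
  next
    case False
    then obtain j where j: "1 \<le> j" "i = f j" by (metis not_le obtain_preimage)
    have "f j \<noteq> j" using j less.prems by metis
    then have "j < i" using j le[of j] by simp
    then obtain a m where "a \<in> {1..k}" "(f ^^ m) a = j" using less.IH[of j] j \<open>f j \<noteq> j\<close> by auto
    then show ?thesis using j by (intro bexI[of _ a] exI[of _ "Suc m"]) auto
  qed
qed

lemma ball_eqI: "a \<in> {1..k} \<Longrightarrow> (f ^^ m) a = i \<Longrightarrow> ball i = a"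
  unfolding ball_def by (rule some_equality) (use origin_unique in blast)+

lemma ball_obtain:
  assumes "1 \<le> i" "f i \<noteq> i"
  obtains m where "ball i \<in> {1..k}" "(f ^^ m) (ball i) = i"
  using origin_exists[OF assms] ball_eqI by metis

lemma ball_init: "i \<in> {1..k} \<Longrightarrow> ball i = i"
  using ball_eqI[of i 0 i] by simp

lemma ball_throw:
  assumes "1 \<le> i" "f i \<noteq> i"
  shows "ball (f i) = ball i"
proof -
  obtain m where "ball i \<in> {1..k}" "(f ^^ m) (ball i) = i" using ball_obtain[OF assms] .
  then show ?thesis using ball_eqI[of "ball i" "Suc m" "f i"] by simp
qed

lemma fixed_shift_iff: "1 \<le> i \<Longrightarrow> f (i + m * n) = i + m * n \<longleftrightarrow> f i = i"
  using shift_mult by simp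

lemma fixed_throw_iff: "1 \<le> i \<Longrightarrow> f (f i) = f i \<longleftrightarrow> f i = i"
  by (metis inj le le_trans)

lemma nonfixed_init: "i \<in> {1..k} \<Longrightarrow> f i \<noteq> i"
  using gt[of i] by auto

text \<open>Translation by \<open>n\<close> commutes with \<open>f\<close>, so it carries the orbit
  of \<open>ball i\<close> into the orbit through \<open>i + n\<close>. It therefore acts on the
  names of balls by sending \<open>a\<close> to \<open>ball (a + n)\<close>.\<close>

lemma ball_shift:
  assumes "1 \<le> i" "f i \<noteq> i"
  shows "ball (i + n) = ball (ball i + n)"
proof -
  obtain m where m: "ball i \<in> {1..k}" "(f ^^ m) (ball i) = i" using ball_obtain[OF assms] .
  have "f (ball i + n) \<noteq> ball i + n"
    using fixed_shift_iff[of "ball i" 1] nonfixed_init m by auto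
  then obtain m' where m': "ball (ball i + n) \<in> {1..k}" "(f ^^ m') (ball (ball i + n)) = ball i + n"
    using ball_obtain[of "ball i + n"] n_pos by auto
  have "(f ^^ (m + m')) (ball (ball i + n)) = i + n"
    using m m' funpow_shift[of "ball i" m] by (simp add: funpow_add)
  then show ?thesis using ball_eqI m' by blast
qed

lemma ball_shift_mult:
  assumes "1 \<le> i" "f i \<noteq> i"
  shows "ball (i + m * n) = ((\<lambda>a. ball (a + n)) ^^ m) (ball i)"
proof (induction m)
  case (Suc m)
  have "ball (i + Suc m * n) = ball ((i + m * n) + n)" by (simp add: algebra_simps)
  also have "\<dots> = ball (ball (i + m * n) + n)"
    using ball_shift[of "i + m * n"] fixed_shift_iff[of i m] assms by simp
  finally show ?case using Suc.IH by simp
qed simp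

text \<open>Translation by \<open>n\<close> acts injectively on the \<open>k\<close> names, so
  \<open>funpow_fact_eq_id\<close> applies to this action.\<close>

lemma ball_shift_fact:
  assumes "1 \<le> i" "f i \<noteq> i"
  shows "ball (i + n * fact k) = ball i"
proof -
  let ?h = "\<lambda>a. ball (a + n)"
  have nf: "f (a + n) \<noteq> a + n" if "a \<in> {1..k}" for a
    using that fixed_shift_iff[of a 1] nonfixed_init by auto
  have maps: "?h ` {1..k} \<subseteq> {1..k}"
  proof (intro image_subsetI)
    fix a assume a: "a \<in> {1..k}"
    show "ball (a + n) \<in> {1..k}" using ball_obtain[of "a + n"] nf[OF a] n_pos by auto
  qed
  \<comment> \<open>When the translates of two names lie on one orbit, undoing the translation
    leaves one name as an iterate of the other. Proper iterates exceed \<open>k\<close>, so the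
    names agree.\<close>
  have aux: "a = b"
    if "(f ^^ m) c = a + n" "(f ^^ (m + d)) c = b + n" "a \<in> {1..k}" "b \<in> {1..k}" for a b c m d
  proof -
    have "(f ^^ d) (a + n) = b + n"
      using that by (metis add.commute funpow_add comp_apply)
    then have "(f ^^ d) a = b" using funpow_shift[of a d] that by simp
    then show ?thesis using funpow_gt[of a d] that by (cases "d = 0") auto
  qed
  have "inj_on ?h {1..k}"
  proof (rule inj_onI)
    fix a b assume ab: "a \<in> {1..k}" "b \<in> {1..k}" "ball (a + n) = ball (b + n)"
    obtain m where m: "(f ^^ m) (ball (a + n)) = a + n"
      using ball_obtain[of "a + n"] nf n_pos ab by auto
    obtain m' where m': "(f ^^ m') (ball (a + n)) = b + n"
      using ball_obtain[of "b + n"] nf n_pos ab by auto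
    show "a = b"
      by (metis aux ab(1,2) m m' le_add_diff_inverse nat_le_linear)
  qed
  then have "(?h ^^ fact (card {1..k})) (ball i) = ball i"
    by (intro funpow_fact_eq_id maps) (use ball_obtain[OF assms] in auto)
  then show ?thesis using ball_shift_mult[OF assms, of "fact k"] by (simp add: mult.commute)
qed

lemma ball_shift_period:
  assumes "1 \<le> i" "f i \<noteq> i"
  shows "ball (i + d * (n * fact k)) = ball i"
proof (induction d)
  case (Suc d)
  have "f (i + d * (n * fact k)) \<noteq> i + d * (n * fact k)"
    using fixed_shift_iff[of i "d * fact k"] assms by (simp add: ac_simps)
  then have "ball (i + d * (n * fact k) + n * fact k) = ball (i + d * (n * fact k))"
    using ball_shift_fact[of "i + d * (n * fact k)"] assms by simp
  then show ?case using Suc.IH by (simp add: algebra_simps)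
qed simp

text \<open>This will recover all signs of a given juggling sequence from those at the times
  \<open>1, ..., k\<close>.\<close>

lemma constant_on_balls:
  assumes "\<And>i. 1 \<le> i \<Longrightarrow> C (f i) = C i" "1 \<le> i" "f i \<noteq> i"
  shows "C i = C (ball i)"
proof -
  obtain m where m: "ball i \<in> {1..k}" "(f ^^ m) (ball i) = i" using ball_obtain[OF assms(2,3)] .
  have "C ((f ^^ m) (ball i)) = C (ball i)"
    using m(1) assms(1) funpow_ge_1 by (induction m) auto
  then show ?thesis using m by simp
qed

end

section \<open>Permutations with ball signs, and their periodic landing maps\<close>

definition drop_perms :: "nat \<Rightarrow> nat \<Rightarrow> ((nat \<Rightarrow> nat) \<times> (nat \<Rightarrow> int)) set" where
  "drop_perms n k = {g. g permutes {1..n} \<and> (\<forall>i\<in>{1..n}. i \<le> g i + k)} \<times> ({1..k} \<rightarrow>\<^sub>E {1, -1})"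

text \<open>The shifts by 1 are due to times starting at 1: a time is split as
  \<open>r + q * n\<close> with \<open>r\<close> in \<open>{1..n}\<close>, so \<open>q\<close>
  counts the full periods before it. The permutation acts inside each period, and everything is then
  delayed by \<open>k\<close>.\<close>

definition periodic_lift :: "nat \<Rightarrow> nat \<Rightarrow> (nat \<Rightarrow> nat) \<Rightarrow> nat \<Rightarrow> nat" where
  "periodic_lift n k g i = (i - 1) div n * n + g ((i - 1) mod n + 1) + k"

lemma periodic_lift_eq:
  assumes "r \<in> {1..n}"
  shows "periodic_lift n k g (r + q * n) = q * n + g r + k"
proof -
  obtain x where "r = Suc x" "x < n" using assms by (cases r) auto
  then show ?thesis by (simp add: periodic_lift_def)
qed

lemma residue_obtain:
  fixes i n :: nat
  assumes "1 \<le> i" "0 < n"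
  obtains r q where "r \<in> {1..n}" "i = r + q * n"
proof
  show "(i - 1) mod n + 1 \<in> {1..n}" using assms by (simp add: Suc_leI)
  show "i = ((i - 1) mod n + 1) + (i - 1) div n * n"
    using assms div_mult_mod_eq[of "i - 1" n] by linarith
qed

lemma residue_unique:
  fixes r r' q q' n :: nat
  assumes "r + q * n = r' + q' * n" "r \<in> {1..n}" "r' \<in> {1..n}"
  shows "r = r' \<and> q = q'"
proof -
  have e: "(r - 1) + q * n = (r' - 1) + q' * n" using assms by auto
  have l: "r - 1 < n" "r' - 1 < n" using assms by auto
  have "((r - 1) + q * n) div n = q" "((r' - 1) + q' * n) div n = q'" using l by simp_all
  then have "q = q'" using e by metis
  then show ?thesis using assms by simp
qed

lemma periodic_throws_lift:
  assumes "0 < n" "g permutes {1..n}" "\<forall>i\<in>{1..n}. i \<le> g i + k"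
  shows "periodic_throws n k (periodic_lift n k g)"
proof
  let ?f = "periodic_lift n k g"
  have g: "g r \<in> {1..n}" if "r \<in> {1..n}" for r
    using assms(2) that by (simp only: permutes_in_image)
  show "0 < n" by fact
  fix i :: nat assume "1 \<le> i"
  then obtain r q where rq: "r \<in> {1..n}" "i = r + q * n" using residue_obtain assms by metis
  show "i \<le> ?f i" using rq periodic_lift_eq[OF rq(1)] assms(3) by force
  have e: "i + n = r + Suc q * n" using rq by simp
  show "?f (i + n) = ?f i + n"
    unfolding e using rq periodic_lift_eq[OF rq(1), of k g "Suc q"] periodic_lift_eq[OF rq(1), of k g q]
    by simp
next
  let ?f = "periodic_lift n k g"
  have g: "g r \<in> {1..n}" if "r \<in> {1..n}" for r
    using assms(2) that by (simp only: permutes_in_image)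
  show "bij_betw ?f {1..} {k<..}"
  proof (rule bij_betw_imageI)
    show "inj_on ?f {1..}"
    proof (rule inj_onI)
      fix i j :: nat assume ij: "i \<in> {1..}" "j \<in> {1..}" "?f i = ?f j"
      obtain r q where rq: "r \<in> {1..n}" "i = r + q * n"
        using residue_obtain assms ij by (metis atLeast_iff)
      obtain r' q' where rq': "r' \<in> {1..n}" "j = r' + q' * n"
        using residue_obtain assms ij by (metis atLeast_iff)
      \<comment> \<open>After the delay \<open>k\<close> is removed, the period and the position
        within it can be compared separately, since \<open>g\<close> preserves
        \<open>{1..n}\<close>.\<close>
      have "g r + q * n = g r' + q' * n"
        using ij rq rq' by (simp add: periodic_lift_eq)
      then have "g r = g r' \<and> q = q'" using residue_unique g rq rq' by blast
      then show "i = j" using rq rq' permutes_inj[OF assms(2)] by (simp add: inj_eq)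
    qed
    show "?f ` {1..} = {k<..}"
    proof (intro equalityI subsetI)
      fix v assume "v \<in> ?f ` {1..}"
      then obtain i where i: "1 \<le> i" "v = ?f i" by auto
      then obtain r q where rq: "r \<in> {1..n}" "i = r + q * n" using residue_obtain assms by metis
      then show "v \<in> {k<..}" using i g[OF rq(1)] by (simp add: periodic_lift_eq)
    next
      fix v assume v: "v \<in> {k<..}"
      then have "1 \<le> v - k" by auto
      then obtain r q where rq: "r \<in> {1..n}" "v - k = r + q * n"
        using residue_obtain assms(1) by metis
      obtain r' where r': "r' \<in> {1..n}" "g r' = r"
        using permutes_image[OF assms(2)] rq by (metis imageE)
      have "?f (r' + q * n) = v" using rq v r' by (simp add: periodic_lift_eq)
      then show "v \<in> ?f ` {1..}" using r' by force
    qed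
  qed
qed

section \<open>Coloured juggling sequences and their data\<close>

definition colored_throws :: "nat \<Rightarrow> nat \<Rightarrow> (nat \<Rightarrow> nat) \<times> (nat \<Rightarrow> int) \<Rightarrow> nat \<Rightarrow> int" where
  "colored_throws n k = (\<lambda>(g, s). \<lambda>i\<in>{1..n * fact k}.
     s (periodic_throws.ball k (periodic_lift n k g) i) * int (periodic_lift n k g i - i))"

text \<open>Solves \<open>t i = g i + k - i\<close> for \<open>g\<close>. The truncated subtraction
  loses nothing on the sequences considered, as their landing times exceed \<open>k\<close>. The
  signs at \<open>1, ..., k\<close> suffice because each ball is named by one of these
  times.\<close>

definition uncolored_data :: "nat \<Rightarrow> nat \<Rightarrow> (nat \<Rightarrow> int) \<Rightarrow> (nat \<Rightarrow> nat) \<times> (nat \<Rightarrow> int)" where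
  "uncolored_data n k T =
     (\<lambda>i. if i \<in> {1..n} then nat \<bar>T i\<bar> + i - k else i, \<lambda>i\<in>{1..k}. sgn (T i))"

lemma window_unique:
  fixes a b c N :: nat
  assumes "a \<in> {c<..c + N}" "b \<in> {c<..c + N}" "a mod N = b mod N"
  shows "a = b"
proof -
  have *: "x = y" if "x \<in> {c<..c + N}" "y \<in> {c<..c + N}" "x mod N = y mod N" "x \<le> y" for x y
  proof (rule ccontr)
    assume "x \<noteq> y"
    moreover have "N dvd y - x" using that by (metis mod_eq_dvd_iff_nat)
    ultimately have "N \<le> y - x" using that by (intro dvd_imp_le) auto
    then show False using that by auto
  qed
  show ?thesis using *[of a b] *[of b a] assms by (metis nat_le_linear)
qed

lemma le_mult_fact: "n \<le> n * (fact k :: nat)"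
  using mult_le_mono2[OF fact_ge_1[of k], of n] by (simp only: mult_1_right)

text \<open>The landing times of one period fill the window \<open>{k<..k + N}\<close>, which gives
  both distinctness modulo \<open>N\<close> and the ground state. Signs are compatible because a
  throw and its landing belong to the same ball, and translation by \<open>N\<close> preserves
  balls.\<close>

lemma colored_throws_in_juggling_seqs:
  assumes "0 < n" "k \<le> n" and p: "(g, s) \<in> drop_perms n k"
  shows "colored_throws n k (g, s) \<in> signed_juggling_seqs n k"
proof -
  define F where "F = periodic_lift n k g"
  define N where "N = n * fact k"
  define T where "T = colored_throws n k (g, s)"
  have g: "g permutes {1..n}" "\<forall>i\<in>{1..n}. i \<le> g i + k" and s: "s \<in> {1..k} \<rightarrow>\<^sub>E {1, -1}"
    using p by (auto simp: drop_perms_def)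
  interpret periodic_throws n k F
    unfolding F_def using periodic_throws_lift assms(1) g by blast
  have Npos: "0 < N" using assms by (simp add: N_def)
  have "n \<le> N" unfolding N_def by (rule le_mult_fact)
  then have kN: "k \<le> N" using assms by simp
  have img: "F ` {1..N} = {k<..k + N}"
    using image_period[of "fact k"] by (simp add: N_def mult.commute)
  have T: "T i = s (ball i) * int (F i - i)" if "i \<in> {1..N}" for i
    using that by (simp add: T_def colored_throws_def F_def N_def)
  have sb: "s (ball i) \<in> {1, -1}" if "1 \<le> i" "F i \<noteq> i" for i
    using ball_obtain[OF that] s by (metis PiE_mem)
  \<comment> \<open>For an empty throw \<open>ball i\<close> may lie outside the domain of
    \<open>s\<close>, hence the separate case in which the product vanishes.\<close>
  have absT: "nat \<bar>T i\<bar> = F i - i" if "i \<in> {1..N}" for i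
    using T[OF that] sb[of i] that by (cases "F i = i") (auto simp: abs_mult)
  have sgnT: "sgn (T i) = (if F i = i then 0 else s (ball i))" if "i \<in> {1..N}" for i
    using T[OF that] sb[of i] that le[of i] by (cases "F i = i") (auto simp: sgn_mult)
  have absF: "nat \<bar>T i\<bar> + i = F i" if "i \<in> {1..N}" for i
    using absT[OF that] le[of i] that by simp
  have abs_seq: "abs_seq N T i = F i - i" if "i \<in> {1..N}" for i
    using absT[OF that] that by (simp add: abs_seq_def)
  have "signed_juggling_seq N T"
    unfolding signed_juggling_seq_def
  proof (intro conjI ballI impI)
    show "T \<in> extensional {1..N}"
      by (simp add: T_def colored_throws_def N_def)
    show "inj_on (\<lambda>i. (nat \<bar>T i\<bar> + i) mod N) {1..N}"
    proof (rule inj_onI)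
      fix i j assume ij: "i \<in> {1..N}" "j \<in> {1..N}"
        "(nat \<bar>T i\<bar> + i) mod N = (nat \<bar>T j\<bar> + j) mod N"
      have "F i \<in> {k<..k + N}" "F j \<in> {k<..k + N}" using img ij by blast+
      then have "F i = F j" using window_unique ij absF by metis
      then show "i = j" using inj ij by simp
    qed
    fix i j assume ij: "i \<in> {1..N}" "j \<in> {1..N}" "[j = i + nat \<bar>T i\<bar>] (mod N)"
    have "1 \<le> F i" using le[of i] ij by simp
    then obtain r q where rq: "r \<in> {1..N}" "F i = r + q * N" using residue_obtain Npos by metis
    have "j mod N = r mod N" using ij absF[of i] rq by (simp add: cong_def add.commute)
    then have "j = r" using window_unique[of j 0 N r] ij rq by auto
    then have Fi: "F i = j + q * N" using rq by simp
    \<comment> \<open>Empty throws have sign \<open>0\<close> whatever their ball, so emptiness has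
      to be carried from \<open>i\<close> to \<open>j\<close> before balls can be compared.\<close>
    have "F (F i) = F i \<longleftrightarrow> F j = j"
      using fixed_shift_iff[of j "q * fact k"] ij unfolding Fi by (simp add: N_def ac_simps)
    then have fixed: "F i = i \<longleftrightarrow> F j = j" using fixed_throw_iff[of i] ij by simp
    have "ball j = ball i" if "F i \<noteq> i"
      using ball_shift_period[of j q] ball_throw[of i] ij that fixed
      unfolding Fi N_def by simp
    then show "sgn (T i) = sgn (T j)" using fixed sgnT ij by simp
  qed
  moreover have jug: "juggles N (abs_seq N T) k"
  proof -
    have "(\<Sum>i = 1..N. abs_seq N T i) = N * k"
      using sum_throws[of "fact k"] abs_seq by (simp add: N_def mult.commute)
    then have "(\<Sum>i = 1..N. real (abs_seq N T i)) = real N * real k"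
      by (metis of_nat_mult of_nat_sum)
    then show ?thesis using Npos by (simp add: juggles_def)
  qed
  moreover have "has_ground_state N (abs_seq N T)"
    unfolding has_ground_state_def
  proof (intro exI[of _ k] conjI allI impI)
    show "juggles N (abs_seq N T) k" by (rule jug)
    fix i :: nat assume i: "1 \<le> i"
    have img_eq: "F ` {1..N} = (\<lambda>j. abs_seq N T j + j) ` {1..N}"
      by (rule image_cong) (use abs_seq le in auto)
    have "(\<exists>j\<in>{1..N}. \<exists>d>0. abs_seq N T j + j = i + d * N) \<longleftrightarrow> (\<exists>d>0. i + d * N \<in> F ` {1..N})"
      unfolding img_eq image_iff Bex_def by metis
    \<comment> \<open>Only \<open>d = 1\<close> can meet the window: \<open>i + N\<close> is at most
      \<open>k + N\<close> exactly when \<open>i\<close> is at most \<open>k\<close>, and it exceeds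
      \<open>k\<close> because \<open>k\<close> is at most \<open>N\<close>.\<close>
    also have "\<dots> \<longleftrightarrow> i \<le> k"
    proof
      assume "\<exists>d>0. i + d * N \<in> F ` {1..N}"
      then obtain d where d: "0 < d" "i + d * N \<le> k + N" unfolding img by auto
      then have "1 * N \<le> d * N" by (intro mult_right_mono) auto
      then show "i \<le> k" using d by linarith
    next
      assume "i \<le> k"
      then have "i + 1 * N \<in> F ` {1..N}" unfolding img using i kN by auto
      then show "\<exists>d>0. i + d * N \<in> F ` {1..N}" by (intro exI[of _ 1]) auto
    qed
    finally show "state N (abs_seq N T) i = (if i \<le> k then 1 else 0)"
      by (simp add: state_def)
  qed
  moreover have "abs_seq N T (i + n) = abs_seq N T i" if "i \<in> {1..N - n}" for i
    using that abs_seq[of i] abs_seq[of "i + n"] shift[of i] by auto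
  ultimately show ?thesis
    unfolding signed_juggling_seqs_def T_def N_def by (simp add: Let_def)
qed

text \<open>On the first period the lift is just \<open>g i + k\<close>. At a time up to
  \<open>k\<close> the throw is nonempty and its ball is named by the time itself, so the sign read
  there is the prescribed one.\<close>

lemma uncolored_colored:
  assumes "0 < n" "k \<le> n" and p: "(g, s) \<in> drop_perms n k"
  shows "uncolored_data n k (colored_throws n k (g, s)) = (g, s)"
proof -
  define F where "F = periodic_lift n k g"
  have g: "g permutes {1..n}" "\<forall>i\<in>{1..n}. i \<le> g i + k" and s: "s \<in> {1..k} \<rightarrow>\<^sub>E {1, -1}"
    using p by (auto simp: drop_perms_def)
  interpret periodic_throws n k F
    unfolding F_def using periodic_throws_lift assms(1) g by blast
  define N where "N = n * fact k"
  have nN: "n \<le> N" unfolding N_def by (rule le_mult_fact)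
  have F: "F i = g i + k" if "i \<in> {1..n}" for i
    using periodic_lift_eq[OF that, of k g 0] by (simp add: F_def)
  have T: "colored_throws n k (g, s) i = s (ball i) * int (F i - i)" if "i \<in> {1..n}" for i
    using that nN by (simp add: colored_throws_def F_def flip: N_def)
  have sb: "s (ball i) \<in> {1, -1}" if "1 \<le> i" "F i \<noteq> i" for i
    using ball_obtain[OF that] s by (metis PiE_mem)
  have "nat \<bar>colored_throws n k (g, s) i\<bar> + i - k = g i" if "i \<in> {1..n}" for i
    using T[OF that] sb[of i] that F[OF that] le[of i]
    by (cases "F i = i") (auto simp: abs_mult)
  moreover have "g i = i" if "i \<notin> {1..n}" for i
    using g that by (simp add: permutes_not_in)
  moreover have "sgn (colored_throws n k (g, s) i) = s i" if "i \<in> {1..k}" for i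
    using T[of i] sb[of i] that assms nonfixed_init[OF that] le[of i] ball_init[OF that]
    by (auto simp: sgn_mult)
  moreover have "s i = undefined" if "i \<notin> {1..k}" for i
    using s that by (rule PiE_arb)
  ultimately show ?thesis
    by (auto simp: uncolored_data_def fun_eq_iff restrict_def)
qed

text \<open>By injectivity modulo \<open>N\<close> and the ground state, every landing time is at least its representative
  modulo \<open>N\<close> in \<open>{k<..k + N}\<close>; the number of balls makes the two sums equal.\<close>

lemma ground_state_landings:
  fixes t :: "nat \<Rightarrow> nat"
  assumes N: "0 < N" and inj: "inj_on (\<lambda>i. (t i + i) mod N) {1..N}"
    and jug: "juggles N t k"
    and state: "\<And>i. 1 \<le> i \<Longrightarrow> state N t i = (if i \<le> k then 1 else 0)"
    and i: "i \<in> {1..N}"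
  shows "t i + i \<in> {k<..k + N}"
proof -
  define f where "f i = t i + i" for i
  \<comment> \<open>The representative of \<open>v\<close> modulo \<open>N\<close> in the window
    \<open>{k<..k + N}\<close>, provided \<open>v\<close> exceeds \<open>k\<close>.\<close>
  define rep where "rep v = k + 1 + (v - (k + 1)) mod N" for v
  have gt: "k < f j" if j: "j \<in> {1..N}" for j
  proof (rule ccontr)
    assume a: "\<not> k < f j"
    \<comment> \<open>A landing time up to \<open>k\<close> is marked in the state, so some throw
      lands there \<open>d\<close> periods later. Injectivity modulo \<open>N\<close> forces it to
      be the same throw, contradicting \<open>d > 0\<close>.\<close>
    then have "state N t (f j) = 1" using state[of "f j"] j by (simp add: f_def)
    then have "\<exists>j'\<in>{1..N}. \<exists>d>0. t j' + j' = f j + d * N"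
      unfolding state_def by (metis zero_neq_one)
    then obtain j' d where j': "j' \<in> {1..N}" "0 < d" "f j' = f j + d * N"
      unfolding f_def by blast
    then have "f j' mod N = f j mod N" by simp
    then have "j' = j" unfolding f_def by (rule inj_onD[OF inj _ j'(1) j])
    then show False using j' N by simp
  qed
  have rep_le: "rep v \<le> v" if "k < v" for v
    using mod_less_eq_dividend[of "v - (k + 1)" N] that unfolding rep_def by linarith
  have rep_mod: "rep v mod N = v mod N" if "k < v" for v
  proof -
    have "(k + 1 + (v - (k + 1)) mod N) mod N = (k + 1 + (v - (k + 1))) mod N"
      by (rule mod_add_right_eq)
    then show ?thesis using that by (simp add: rep_def)
  qed
  have "inj_on (rep \<circ> f) {1..N}"
  proof (rule inj_onI)
    fix a b assume ab: "a \<in> {1..N}" "b \<in> {1..N}" "(rep \<circ> f) a = (rep \<circ> f) b"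
    then have "f a mod N = f b mod N" using rep_mod gt by (metis comp_apply)
    then show "a = b" unfolding f_def by (rule inj_onD[OF inj _ ab(1,2)])
  qed
  moreover have "(rep \<circ> f) ` {1..N} \<subseteq> {k<..k + N}"
    using N by (auto simp: rep_def Suc_leI)
  moreover have "card {1..N} = card {k<..k + N}" by simp
  ultimately have "bij_betw (rep \<circ> f) {1..N} {k<..k + N}"
    by (metis bij_betw_def card_image card_subset_eq finite_greaterThanAtMost)
  then have "(\<Sum>j = 1..N. rep (f j)) = \<Sum>{k<..k + N}"
    using sum.reindex_bij_betw[of "rep \<circ> f" "{1..N}" "{k<..k + N}" "\<lambda>x. x"] by simp
  also have "{k<..k + N} = (\<lambda>i. i + k) ` {1..N}"
    by (auto simp: image_iff intro!: bexI[of _ "_ - k"])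
  also have "\<Sum>\<dots> = (\<Sum>i = 1..N. i + k)"
    by (subst sum.reindex) (auto simp: inj_on_def)
  also have "\<dots> = N * k + (\<Sum>i = 1..N. i)"
    by (simp add: sum.distrib)
  also have "N * k = (\<Sum>j = 1..N. t j)"
  proof -
    have "(\<Sum>j = 1..N. real (t j)) = real N * real k"
      using jug N by (simp add: juggles_def field_simps)
    then have "real (\<Sum>j = 1..N. t j) = real (N * k)" by simp
    then show ?thesis by (simp only: of_nat_eq_iff)
  qed
  also have "(\<Sum>j = 1..N. t j) + (\<Sum>i = 1..N. i) = (\<Sum>j = 1..N. f j)"
    by (simp add: f_def sum.distrib)
  \<comment> \<open>Termwise inequality together with equal sums forces equality in every
    term.\<close>
  finally have "rep (f i) = f i"
    by (rule sum_mono_inv[OF _ _ i]) (use rep_le gt in auto)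
  moreover have "rep (f i) \<le> k + N"
    using N by (simp add: rep_def Suc_leI)
  ultimately show ?thesis using gt[OF i] by (simp add: f_def)
qed

text \<open>The ground state confines the landings of the long period \<open>N\<close>, and
  \<open>n\<close>-periodicity of the heights refines this to the first \<open>n\<close> throws,
  which yields the permutation. The sign condition makes the colouring constant on orbits, so the
  first \<open>k\<close> signs determine it.\<close>

lemma colored_uncolored:
  assumes n: "0 < n" "k \<le> n" and T: "T \<in> signed_juggling_seqs n k"
  shows "uncolored_data n k T \<in> drop_perms n k" (is ?mem)
    and "colored_throws n k (uncolored_data n k T) = T" (is ?eq)
proof -
  define N where "N = n * fact k"
  define f where "f i = nat \<bar>T i\<bar> + i" for i
  define g where "g = fst (uncolored_data n k T)"
  define s where "s = snd (uncolored_data n k T)"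
  have gs: "uncolored_data n k T = (g, s)" by (simp add: g_def s_def)
  have g_in: "g i = f i - k" if "i \<in> {1..n}" for i
    using that by (simp add: g_def uncolored_data_def f_def)
  have g_out: "g i = i" if "i \<notin> {1..n}" for i
    using that by (auto simp: g_def uncolored_data_def)
  have s_in: "s i = sgn (T i)" if "i \<in> {1..k}" for i
    using that by (simp add: s_def uncolored_data_def)
  have nN: "n \<le> N" unfolding N_def by (rule le_mult_fact)
  then have N: "0 < N" using n by simp
  have sj: "signed_juggling_seq N T" and jug: "juggles N (abs_seq N T) k"
    and gr: "has_ground_state N (abs_seq N T)"
    and per: "\<And>i. i \<in> {1..N - n} \<Longrightarrow> abs_seq N T (i + n) = abs_seq N T i"
    using T by (auto simp: signed_juggling_seqs_def N_def Let_def)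
  have ext: "T \<in> extensional {1..N}"
    and inj: "inj_on (\<lambda>i. f i mod N) {1..N}"
    and sgn: "\<And>i j. i \<in> {1..N} \<Longrightarrow> j \<in> {1..N} \<Longrightarrow> [j = f i] (mod N) \<Longrightarrow> sgn (T i) = sgn (T j)"
    using sj unfolding signed_juggling_seq_def f_def by (auto simp: add.commute)
  have abs_f: "abs_seq N T i + i = f i" if "i \<in> {1..N}" for i
    using that by (simp add: abs_seq_def f_def)
  have f_in: "f i \<in> {k<..k + N}" if "i \<in> {1..N}" for i
  proof -
    obtain k' where k': "juggles N (abs_seq N T) k'"
      "\<And>i. 1 \<le> i \<Longrightarrow> state N (abs_seq N T) i = (if i \<le> k' then 1 else 0)"
      using gr by (auto simp: has_ground_state_def)
    \<comment> \<open>The number of balls is an average, hence unique, so the ground state is the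
      one with \<open>k\<close> ones.\<close>
    have "k' = k" using jug k'(1) by (simp add: juggles_def)
    moreover have "inj_on (\<lambda>i. (abs_seq N T i + i) mod N) {1..N}"
      by (rule inj_on_cong[THEN iffD2, OF _ inj]) (use abs_f in simp)
    ultimately have "abs_seq N T i + i \<in> {k<..k + N}"
      using ground_state_landings[OF N _ jug] k' that by blast
    then show ?thesis using abs_f that by simp
  qed
  have f_shift: "f (i + q * n) = f i + q * n" if "1 \<le> i" "i + q * n \<le> N" for i q
    using that
  proof (induction q)
    case (Suc q)
    have "abs_seq N T (i + q * n + n) = abs_seq N T (i + q * n)"
      using Suc.prems by (intro per) auto
    then show ?case
      using Suc abs_f[of "i + q * n"] abs_f[of "i + q * n + n"] by (simp add: algebra_simps)
  qed simp
  have f_n: "f i \<in> {k<..k + n}" if "i \<in> {1..n}" for i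
  proof -
    \<comment> \<open>The bound \<open>k + N\<close> is applied to the translate of \<open>i\<close>
      in the last block of length \<open>n\<close> and then moved back to the first block.\<close>
    have "(fact k - 1) * n + n = N"
      by (simp add: N_def algebra_simps)
    moreover have "f (i + (fact k - 1) * n) = f i + (fact k - 1) * n"
      using f_shift that calculation by auto
    moreover have "f (i + (fact k - 1) * n) \<le> k + N"
      using f_in[of "i + (fact k - 1) * n"] that calculation by auto
    ultimately show ?thesis using f_in[of i] that nN by auto
  qed
  have "inj_on g {1..n}"
  proof (rule inj_onI)
    fix i j assume ij: "i \<in> {1..n}" "j \<in> {1..n}" "g i = g j"
    then have "f i - k = f j - k" using g_in by simp
    moreover have "k < f i" "k < f j" using f_n ij by auto
    ultimately have "f i = f j" by linarith
    then have "f i mod N = f j mod N" by simp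
    then show "i = j" by (rule inj_onD[OF inj]) (use ij nN in auto)
  qed
  moreover have "g ` {1..n} \<subseteq> {1..n}"
    using f_n g_in by fastforce
  ultimately have "bij_betw g {1..n} {1..n}"
    by (simp add: bij_betw_def endo_inj_surj)
  then have gperm: "g permutes {1..n}"
    using g_out by (intro bij_imp_permutes) auto
  have gdrop: "\<forall>i\<in>{1..n}. i \<le> g i + k"
    using g_in by (auto simp: f_def)
  have Tnz: "T i \<noteq> 0" if "i \<in> {1..k}" for i
    using f_in[of i] that n nN by (auto simp: f_def)
  have "s \<in> {1..k} \<rightarrow>\<^sub>E {1, -1}"
  proof (rule PiE_I)
    fix i assume "i \<in> {1..k}"
    then show "s i \<in> {1, -1}" using Tnz s_in by (auto simp: sgn_if)
  qed (auto simp: s_def uncolored_data_def)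
  with gperm gdrop show ?mem by (simp add: gs drop_perms_def)
  define F where "F = periodic_lift n k g"
  interpret periodic_throws n k F
    unfolding F_def using periodic_throws_lift n gperm gdrop by blast
  have F_f: "F i = f i" if "i \<in> {1..N}" for i
  proof -
    have "1 \<le> i" using that by simp
    then obtain r q where rq: "r \<in> {1..n}" "i = r + q * n"
      using residue_obtain n(1) by metis
    show ?thesis
      using rq f_shift[of r q] that g_in[OF rq(1)] f_n[OF rq(1)] nN
      by (simp add: F_def periodic_lift_eq)
  qed
  \<comment> \<open>The signs are continued with period \<open>N\<close>, since
    \<open>constant_on_balls\<close> asks for invariance under throws at all positive times.\<close>
  define C where "C i = sgn (T ((i - 1) mod N + 1))" for i
  have C_eq: "C (r + q * N) = sgn (T r)" if r: "r \<in> {1..N}" for r q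
  proof -
    obtain x where "r = Suc x" "x < N" using r by (cases r) auto
    then show ?thesis by (simp add: C_def)
  qed
  \<comment> \<open>Both the throw and its landing are reduced to \<open>{1..N}\<close>, where the
    sign condition on \<open>T\<close> compares them.\<close>
  have C_throw: "C (F i) = C i" if i: "1 \<le> i" for i
  proof -
    obtain r q where rq: "r \<in> {1..N}" "i = r + q * N" using residue_obtain i N by metis
    have "1 \<le> F r" using le[of r] rq by simp
    then obtain r' q' where rq': "r' \<in> {1..N}" "F r = r' + q' * N" using residue_obtain N by metis
    have "F i = F r + q * N"
      using shift_mult[of r "q * fact k"] rq by (simp add: N_def ac_simps)
    then have "F i = r' + (q' + q) * N" using rq' by (simp add: algebra_simps)
    moreover have "sgn (T r) = sgn (T r')"
      using sgn[OF rq(1) rq'(1)] rq' F_f[OF rq(1)] by (simp add: cong_def flip: F_f)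
    ultimately show ?thesis using C_eq rq rq' by metis
  qed
  show ?eq
  proof
    fix i
    show "colored_throws n k (uncolored_data n k T) i = T i"
    proof (cases "i \<in> {1..N}")
      case False
      then show ?thesis
        using ext by (auto simp: gs colored_throws_def extensional_def simp flip: N_def)
    next
      case True
      have eq: "colored_throws n k (uncolored_data n k T) i = s (ball i) * int (F i - i)"
        using True by (simp add: gs colored_throws_def F_def flip: N_def)
      have abs: "int (F i - i) = \<bar>T i\<bar>" using F_f[OF True] by (simp add: f_def)
      show ?thesis
      proof (cases "F i = i")
        case True
        then show ?thesis using eq abs by simp
      next
        case nf: False
        then have b: "ball i \<in> {1..k}" using ball_obtain True by (metis atLeastAtMost_iff)
        have "C i = C (ball i)" using constant_on_balls[of C i] C_throw nf True by auto
        then have "sgn (T i) = s (ball i)"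
          using C_eq[of i 0] C_eq[of "ball i" 0] True b s_in n nN by auto
        then show ?thesis using eq abs by (metis mult.commute abs_mult_sgn)
      qed
    qed
  qed
qed

lemma bij_betw_colored_throws:
  assumes "0 < n" "k \<le> n"
  shows "bij_betw (colored_throws n k) (drop_perms n k) (signed_juggling_seqs n k)"
  by (rule bij_betw_byWitness[where f' = "uncolored_data n k"])
     (use colored_throws_in_juggling_seqs uncolored_colored colored_uncolored assms in auto)

section \<open>Signed permutations and their data\<close>

definition unsigned_data :: "nat \<Rightarrow> nat \<Rightarrow> (int \<Rightarrow> int) \<Rightarrow> (nat \<Rightarrow> nat) \<times> (nat \<Rightarrow> int)" where
  "unsigned_data n k \<pi> =
     (\<lambda>i. if i \<in> {1..n} then nat \<bar>\<pi> (int i)\<bar> else i, \<lambda>i\<in>{1..k}. sgn (\<pi> (int i)))"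

text \<open>The factor \<open>sgn x\<close> makes the map odd and sends 0 to 0. Positions beyond
  \<open>k\<close> get sign \<open>1\<close>, since a negative entry there would violate the bound
  on the drop.\<close>

definition signed_perm :: "nat \<Rightarrow> nat \<Rightarrow> (nat \<Rightarrow> nat) \<times> (nat \<Rightarrow> int) \<Rightarrow> int \<Rightarrow> int" where
  "signed_perm n k = (\<lambda>(g, s) x. if x \<in> {- int n..int n}
     then sgn x * (if nat \<bar>x\<bar> \<in> {1..k} then s (nat \<bar>x\<bar>) else 1) * int (g (nat \<bar>x\<bar>)) else x)"

lemma signed_perms_maxdrop_le_iff:
  assumes "0 < n"
  shows "\<pi> \<in> signed_perms_maxdrop_le n k \<longleftrightarrow> \<pi> \<in> signed_perms n \<and>
    (\<forall>i\<in>{1..int n}. (0 < \<pi> i \<longrightarrow> i - \<pi> i \<le> int k) \<and> (\<pi> i < 0 \<longrightarrow> i \<le> int k))"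
proof (cases "\<pi> \<in> signed_perms n")
  case True
  let ?A = "{i - \<pi> i | i. 1 \<le> i \<and> i \<le> int n \<and> \<pi> i > 0}"
  let ?B = "{i. 1 \<le> i \<and> i \<le> int n \<and> \<pi> i < 0}"
  have perm: "\<pi> permutes {- int n..int n}" and odd: "\<forall>i\<in>{- int n..int n}. \<pi> (- i) = - \<pi> i"
    using True unfolding signed_perms_def by auto
  \<comment> \<open>\<open>Max_le_iff\<close> needs a nonempty set. Oddness gives the value at 0,
    and injectivity then makes position 1 contribute to one of the two sets.\<close>
  have "\<pi> 0 = 0" using bspec[OF odd, of 0] by simp
  then have "\<pi> 1 \<noteq> 0"
    using permutes_inj[OF perm] by (metis injD zero_neq_one)
  then have "1 - \<pi> 1 \<in> ?A \<or> 1 \<in> ?B" using assms by force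
  then have ne: "?A \<union> ?B \<noteq> {}" by blast
  have "?A \<subseteq> (\<lambda>i. i - \<pi> i) ` {1..int n}" "?B \<subseteq> {1..int n}" by auto
  then have "finite (?A \<union> ?B)" by (meson finite_Un finite_atLeastAtMost_int finite_imageI finite_subset)
  then have "maxdrop_B n \<pi> \<le> int k \<longleftrightarrow> (\<forall>a\<in>?A \<union> ?B. a \<le> int k)"
    unfolding maxdrop_B_def using ne by (rule Max_le_iff)
  also have "\<dots> \<longleftrightarrow> (\<forall>i\<in>{1..int n}. (0 < \<pi> i \<longrightarrow> i - \<pi> i \<le> int k) \<and> (\<pi> i < 0 \<longrightarrow> i \<le> int k))"
    unfolding ball_Un by auto blast
  finally show ?thesis
    using True by (simp add: signed_perms_maxdrop_le_def)
qed (simp add: signed_perms_maxdrop_le_def)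

text \<open>For a positive entry the drop bound is the inequality \<open>i \<le> g i + k\<close>
  itself. A negative entry has \<open>i \<le> k\<close>, which implies that inequality.\<close>

lemma signed_perm_unsigned_data:
  assumes "0 < n" "k \<le> n" and "\<pi> \<in> signed_perms_maxdrop_le n k"
  shows "unsigned_data n k \<pi> \<in> drop_perms n k" (is ?mem)
    and "signed_perm n k (unsigned_data n k \<pi>) = \<pi>" (is ?eq)
proof -
  define g where "g = fst (unsigned_data n k \<pi>)"
  define s where "s = snd (unsigned_data n k \<pi>)"
  have gs: "unsigned_data n k \<pi> = (g, s)" by (simp add: g_def s_def)
  have g_in: "g i = nat \<bar>\<pi> (int i)\<bar>" if "i \<in> {1..n}" for i
    using that by (simp add: g_def unsigned_data_def)
  have g_out: "g i = i" if "i \<notin> {1..n}" for i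
    using that by (auto simp: g_def unsigned_data_def)
  have s_in: "s i = sgn (\<pi> (int i))" if "i \<in> {1..k}" for i
    using that by (simp add: s_def unsigned_data_def)
  have perm: "\<pi> permutes {- int n..int n}"
    and odd: "\<And>i. i \<in> {- int n..int n} \<Longrightarrow> \<pi> (- i) = - \<pi> i"
    and drop: "\<And>i. i \<in> {1..int n} \<Longrightarrow> 0 < \<pi> i \<Longrightarrow> i - \<pi> i \<le> int k"
    and neg: "\<And>i. i \<in> {1..int n} \<Longrightarrow> \<pi> i < 0 \<Longrightarrow> i \<le> int k"
    using assms by (auto simp: signed_perms_maxdrop_le_iff signed_perms_def)
  have zero: "\<pi> 0 = 0" using odd[of 0] by simp
  have \<pi>_inj: "x = y" if "\<pi> x = \<pi> y" for x y
    using permutes_inj[OF perm] that by (simp add: inj_eq)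
  have nz: "\<pi> x \<noteq> 0" if "x \<noteq> 0" for x using \<pi>_inj zero that by metis
  have range: "\<pi> x \<in> {- int n..int n}" if "x \<in> {- int n..int n}" for x
    using perm that by (simp only: permutes_in_image)
  have "inj_on g {1..n}"
  proof (rule inj_onI)
    fix i j assume ij: "i \<in> {1..n}" "j \<in> {1..n}" "g i = g j"
    \<comment> \<open>Oddness turns the opposite value into the value at \<open>- int j\<close>.
      Injectivity then leaves \<open>i = j\<close>, as both positions are positive.\<close>
    then have "\<pi> (int i) = \<pi> (int j) \<or> \<pi> (int i) = - \<pi> (int j)" using g_in by auto
    then have "\<pi> (int i) = \<pi> (int j) \<or> \<pi> (int i) = \<pi> (- int j)" using odd[of "int j"] ij by auto
    then have "int i = int j \<or> int i = - int j" using \<pi>_inj by blast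
    then show "i = j" using ij by auto
  qed
  moreover have "g ` {1..n} \<subseteq> {1..n}"
  proof (intro image_subsetI)
    fix i assume i: "i \<in> {1..n}"
    show "g i \<in> {1..n}" using g_in[OF i] nz[of "int i"] range[of "int i"] i by auto
  qed
  ultimately have "bij_betw g {1..n} {1..n}"
    by (simp add: bij_betw_def endo_inj_surj)
  then have "g permutes {1..n}"
    using g_out by (intro bij_imp_permutes) auto
  moreover have "\<forall>i\<in>{1..n}. i \<le> g i + k"
  proof
    fix i assume i: "i \<in> {1..n}"
    show "i \<le> g i + k"
      using g_in[OF i] nz[of "int i"] drop[of "int i"] neg[of "int i"] i
      by (cases "0 < \<pi> (int i)") auto
  qed
  moreover have "s \<in> {1..k} \<rightarrow>\<^sub>E {1, -1}"
  proof (rule PiE_I)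
    fix i assume "i \<in> {1..k}"
    then show "s i \<in> {1, -1}" using nz[of "int i"] s_in by (auto simp: sgn_if)
  qed (auto simp: s_def unsigned_data_def)
  ultimately show ?mem by (simp add: gs drop_perms_def)
  have pos: "signed_perm n k (g, s) (int i) = \<pi> (int i)" if i: "i \<in> {1..n}" for i
  proof (cases "i \<le> k")
    case True
    then show ?thesis
      using i g_in[OF i] s_in[of i] by (auto simp: signed_perm_def sgn_mult_abs)
  next
    case False
    then have "0 < \<pi> (int i)" using neg[of "int i"] nz[of "int i"] i by fastforce
    then show ?thesis
      using False i g_in[OF i] by (simp add: signed_perm_def)
  qed
  show ?eq
  proof
    fix x
    consider "x \<notin> {- int n..int n}" | "x = 0" | i where "i \<in> {1..n}" "x = int i"
      | i where "i \<in> {1..n}" "x = - int i"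
    proof (cases x rule: int_cases2)
      case (nonneg m)
      then show ?thesis using that(1,2) that(3)[of m] by (cases "m = 0"; cases "m \<le> n") auto
    next
      case (nonpos m)
      then show ?thesis using that(1,2) that(4)[of m] by (cases "m = 0"; cases "m \<le> n") auto
    qed
    then show "signed_perm n k (unsigned_data n k \<pi>) x = \<pi> x"
    proof cases
      case 1
      then show ?thesis using permutes_not_in[OF perm] by (auto simp: gs signed_perm_def)
    next
      case 2
      then show ?thesis using zero by (simp add: gs signed_perm_def)
    next
      case (3 i)
      then show ?thesis using pos by (simp add: gs)
    next
      case (4 i)
      have "signed_perm n k (g, s) (- int i) = - signed_perm n k (g, s) (int i)"
        using 4 by (simp add: signed_perm_def)
      then show ?thesis using 4 pos[of i] odd[of "int i"] by (simp add: gs)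
    qed
  qed
qed

lemma unsigned_data_signed_perm:
  assumes "0 < n" "k \<le> n" and p: "(g, s) \<in> drop_perms n k"
  shows "signed_perm n k (g, s) \<in> signed_perms_maxdrop_le n k" (is ?mem)
    and "unsigned_data n k (signed_perm n k (g, s)) = (g, s)" (is ?eq)
proof -
  define \<pi> where "\<pi> = signed_perm n k (g, s)"
  \<comment> \<open>The signs continued by \<open>1\<close> beyond \<open>k\<close>, so that
    positions on both sides of \<open>k\<close> are treated uniformly.\<close>
  define e where "e i = (if i \<in> {1..k} then s i else 1)" for i
  have g: "g permutes {1..n}" "\<And>i. i \<in> {1..n} \<Longrightarrow> i \<le> g i + k" and s: "s \<in> {1..k} \<rightarrow>\<^sub>E {1, -1}"
    using p by (auto simp: drop_perms_def)
  have e: "e i = 1 \<or> e i = -1" for i using s by (auto simp: e_def)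
  have g_range: "g i \<in> {1..n}" if "i \<in> {1..n}" for i
    using g(1) that by (simp only: permutes_in_image)
  have \<pi>_in: "\<pi> x = sgn x * e (nat \<bar>x\<bar>) * int (g (nat \<bar>x\<bar>))" if "x \<in> {- int n..int n}" for x
    using that by (simp add: \<pi>_def signed_perm_def e_def)
  have \<pi>_out: "\<pi> x = x" if "x \<notin> {- int n..int n}" for x
    using that by (auto simp: \<pi>_def signed_perm_def)
  have \<pi>_pos: "\<pi> (int i) = e i * int (g i)" if "i \<in> {1..n}" for i
    using \<pi>_in[of "int i"] that by simp
  have \<pi>_zero: "\<pi> 0 = 0" using \<pi>_in[of 0] by simp
  have abs_nz: "nat \<bar>x\<bar> \<in> {1..n} \<and> \<bar>\<pi> x\<bar> = int (g (nat \<bar>x\<bar>))"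
    if "x \<in> {- int n..int n}" "x \<noteq> 0" for x
    using that \<pi>_in[of x] e[of "nat \<bar>x\<bar>"] by (auto simp: abs_mult sgn_if)
  have odd: "\<pi> (- x) = - \<pi> x" if "x \<in> {- int n..int n}" for x
    using \<pi>_in[of x] \<pi>_in[of "- x"] that by simp
  have nz: "\<pi> x \<noteq> 0" if "x \<in> {- int n..int n}" "x \<noteq> 0" for x
    using abs_nz[OF that] g_range[of "nat \<bar>x\<bar>"] by auto
  have "inj_on \<pi> {- int n..int n}"
  proof (rule inj_onI)
    fix x y assume xy: "x \<in> {- int n..int n}" "y \<in> {- int n..int n}" "\<pi> x = \<pi> y"
    show "x = y"
    proof (cases "x = 0 \<or> y = 0")
      case True
      then show ?thesis using xy nz \<pi>_zero by metis
    next
      case False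
      then have "g (nat \<bar>x\<bar>) = g (nat \<bar>y\<bar>)" using xy abs_nz by (metis of_nat_eq_iff)
      then have "nat \<bar>x\<bar> = nat \<bar>y\<bar>" using permutes_inj[OF g(1)] by (simp add: inj_eq)
      then have "x = y \<or> x = - y" by linarith
      \<comment> \<open>Otherwise oddness would make \<open>\<pi> y\<close> its own negative,
        although it is nonzero.\<close>
      moreover have "x \<noteq> - y"
      proof
        assume "x = - y"
        then have "\<pi> y = - \<pi> y" using odd[OF xy(2)] xy(3) by simp
        then show False using nz[OF xy(2)] False by simp
      qed
      ultimately show ?thesis by blast
    qed
  qed
  moreover have "\<pi> ` {- int n..int n} \<subseteq> {- int n..int n}"
  proof (intro image_subsetI)
    fix x assume x: "x \<in> {- int n..int n}"
    show "\<pi> x \<in> {- int n..int n}"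
    proof (cases "x = 0")
      case False
      then have "\<bar>\<pi> x\<bar> \<le> int n" using abs_nz[OF x] g_range[of "nat \<bar>x\<bar>"] by simp
      then show ?thesis by (auto simp: abs_le_iff)
    qed (simp add: \<pi>_zero)
  qed
  ultimately have "bij_betw \<pi> {- int n..int n} {- int n..int n}"
    by (simp add: bij_betw_def endo_inj_surj)
  then have "\<pi> permutes {- int n..int n}"
    using \<pi>_out by (intro bij_imp_permutes) auto
  then have "\<pi> \<in> signed_perms n" using odd by (simp add: signed_perms_def)
  moreover have "(0 < \<pi> i \<longrightarrow> i - \<pi> i \<le> int k) \<and> (\<pi> i < 0 \<longrightarrow> i \<le> int k)"
    if i: "i \<in> {1..int n}" for i
  proof -
    obtain j where j: "i = int j" "j \<in> {1..n}"
    proof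
      show "i = int (nat i)" "nat i \<in> {1..n}" using i by auto
    qed
    \<comment> \<open>Negative entries occur only at positions up to \<open>k\<close>, which is the
      second half of the drop condition.\<close>
    have "e j = -1 \<Longrightarrow> j \<le> k" by (auto simp: e_def split: if_splits)
    then show ?thesis using j \<pi>_pos[OF j(2)] g(2)[OF j(2)] e[of j] by auto
  qed
  ultimately show ?mem
    using signed_perms_maxdrop_le_iff[OF assms(1)] by (simp add: \<pi>_def)
  have "nat \<bar>\<pi> (int i)\<bar> = g i" if "i \<in> {1..n}" for i
    using \<pi>_pos[OF that] e[of i] by auto
  moreover have "g i = i" if "i \<notin> {1..n}" for i
    using g that by (simp add: permutes_not_in)
  moreover have "sgn (\<pi> (int i)) = s i" if "i \<in> {1..k}" for i
  proof -
    have i: "i \<in> {1..n}" using that assms by auto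
    have "e i = s i" using that by (simp add: e_def)
    then show ?thesis using \<pi>_pos[OF i] g_range[OF i] e[of i] by (auto simp: sgn_mult)
  qed
  moreover have "s i = undefined" if "i \<notin> {1..k}" for i
    using s that by (rule PiE_arb)
  ultimately show ?eq
    by (auto simp: unsigned_data_def fun_eq_iff restrict_def simp flip: \<pi>_def)
qed

lemma bij_betw_unsigned_data:
  assumes "0 < n" "k \<le> n"
  shows "bij_betw (unsigned_data n k) (signed_perms_maxdrop_le n k) (drop_perms n k)"
  by (rule bij_betw_byWitness[where f' = "signed_perm n k"])
     (use signed_perm_unsigned_data unsigned_data_signed_perm assms in auto)

theorem theorem4p3:
  fixes n k :: nat
  assumes "n \<ge> 1" and "k \<le> n"
  shows "\<exists>\<psi>. bij_betw \<psi> (signed_perms_maxdrop_le n k) (signed_juggling_seqs n k)"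
proof -
  have "0 < n" using assms by simp
  then show ?thesis
    using bij_betw_trans[OF bij_betw_unsigned_data bij_betw_colored_throws] assms by blast
qed

end
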